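(* Let $h>0$, $s\ge 1$, and let $u,v$ be the polynomials of degree at most $s$ and $\lambda_1,\dots,\lambda_s\in\mathbb{R}^\nu$ vectors such that $$\dot u(ch)=M^{-1}\sum_{j=0}^{s-1}P_j(c)\gamma_j(v),\quad u(0)=q_0,\qquad \dot v(ch)=\sum_{j=0}^{s-1}P_j(c)\psi_j(u)-\sum_{j=1}^{s}\ell_j(c)\,\nabla g(u(c_jh))\lambda_j,\quad v(0)=p_0,\qquad c\in[0,1].$$ Set $q_1:=u(h)$, $p_1:=v(h)$. Assume that $\nabla g(u(c_ih))^\top M^{-1}v(c_ih)=0\in\mathbb{R}^\nu$ for $i=1,\dots,s$. Then $H(q_1,p_1)=H(q_0,p_0)$, i.e., the energy is conserved.
   Context: Problem. Let $1\le\nu\le m$, let $M\in\mathbb{R}^{m\times m}$ be symmetric positive definite, let $U$ be a real-valued function analytic on an open set $D\subseteq\mathbb{R}^m$ (the domain of interest, in which all position values considered lie), and let $g:\mathbb{R}^m\to\mathbb{R}^\nu$ have quadratic polynomial entries. $\nabla g(q)\in\mathbb{R}^{m\times\nu}$ is the matrix whose columns are the gradients of the entries of $g$. It is assumed that $\nabla g(q)^\top M^{-1}\nabla g(q)$ is symmetric positive definite for $q\in D$, with smallest eigenvalue bounded away from $0$. The Hamiltonian is $H(q,p)=\frac12p^\top M^{-1}p-U(q)$, and the constrained Hamiltonian problem is $\dot q=M^{-1}p$, $\dot p=\nabla U(q)-\nabla g(q)\lambda$, $g(q)=0$, with consistent initial values $q(0)=q_0$, $p(0)=p_0$: $g(q_0)=0$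 and $\nabla g(q_0)^\top M^{-1}p_0=0$. Notation. $P_j$, $j\ge0$, is the Legendre polynomial of degree $j$ shifted to $[0,1]$ and scaled so that $\int_0^1P_iP_j\,dx=\delta_{ij}$; $0<c_1<\dots<c_s<1$ are the zeros of $P_s$; $\ell_1,\dots,\ell_s$ are the Lagrange basis polynomials (degree $s-1$) on the nodes $c_1,\dots,c_s$. The dot denotes the derivative with respect to time $t=ch\in[0,h]$. For functions $u,v$ on $[0,h]$, $\gamma_j(v)=\int_0^1P_j(\zeta)v(\zeta h)\,d\zeta$ and $\psi_j(u)=\int_0^1P_j(\zeta)\nabla U(u(\zeta h))\,d\zeta$. *)

theory Defs
  imports "HOL-Analysis.Analysis"
begin

definition sym_pos_def :: "real ^ 'n ^ 'n \<Rightarrow> bool" where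
  "sym_pos_def A \<longleftrightarrow> transpose A = A \<and> (\<forall>x. x \<noteq> 0 \<longrightarrow> 0 < x \<bullet> (A *v x))"

(* Meaningful for symmetric matrices, whose set of real eigenvalues is finite and nonempty. *)
definition smallest_eigenvalue :: "real ^ 'n ^ 'n \<Rightarrow> real" where
  "smallest_eigenvalue A = Min {\<mu>. \<exists>x. x \<noteq> 0 \<and> A *v x = \<mu> *\<^sub>R x}"

(* The gradient is unique where it exists; the value is arbitrary at points where the
   function is not differentiable. *)
definition grad :: "('a::real_inner \<Rightarrow> real) \<Rightarrow> 'a \<Rightarrow> 'a" where
  "grad f x = (THE d. GDERIV f x :> d)"

(* The m x n matrix whose j-th column is the gradient of the j-th entry of g, that is, the
   transpose of the Jacobian. *)
definition grad_matrix :: "(real ^ 'm \<Rightarrow> real ^ 'n) \<Rightarrow> real ^ 'm \<Rightarrow> real ^ 'n ^ 'm" where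
  "grad_matrix g q = (\<chi> i j. grad (\<lambda>x. g x $ j) q $ i)"

(* Locally the sum of a power series in m real variables. The multi-index \<alpha> ranges over all
   functions from the index type to nat, and has_sum is unconditional, hence absolute,
   convergence. *)
definition real_analytic_on :: "(real ^ 'm \<Rightarrow> real) \<Rightarrow> (real ^ 'm) set \<Rightarrow> bool" where
  "real_analytic_on f D \<longleftrightarrow>
     (\<forall>x\<in>D. \<exists>r>0. \<exists>a :: ('m \<Rightarrow> nat) \<Rightarrow> real. \<forall>y\<in>ball x r.
        ((\<lambda>\<alpha>. a \<alpha> * (\<Prod>i\<in>UNIV. (y $ i - x $ i) ^ \<alpha> i)) has_sum f y) UNIV)"

(* A may vanish: affine functions are included. *)
definition quadratic_polynomial :: "(real ^ 'm \<Rightarrow> real) \<Rightarrow> bool" where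
  "quadratic_polynomial f \<longleftrightarrow>
     (\<exists>(A :: real ^ 'm ^ 'm) b d. \<forall>q. f q = q \<bullet> (A *v q) + b \<bullet> q + d)"

definition polynomial_curve :: "nat \<Rightarrow> (real \<Rightarrow> 'a::real_vector) \<Rightarrow> bool" where
  "polynomial_curve s w \<longleftrightarrow> (\<exists>a :: nat \<Rightarrow> 'a. \<forall>t. w t = (\<Sum>k\<le>s. t ^ k *\<^sub>R a k))"

definition hamiltonian ::
    "real ^ 'm ^ 'm \<Rightarrow> (real ^ 'm \<Rightarrow> real) \<Rightarrow> real ^ 'm \<Rightarrow> real ^ 'm \<Rightarrow> real" where
  "hamiltonian M U q p = 1/2 * (p \<bullet> (matrix_inv M *v p)) - U q"

(* Rodrigues' formula shifted to [0,1], (1 / n!) (d/dx)^n (x^2 - x)^n, scaled to unit L2 norm;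
   see degree_legendre01 and legendre01_orthonormal. *)
definition legendre01 :: "nat \<Rightarrow> real poly" where
  "legendre01 n = smult (sqrt (2 * real n + 1) / fact n) ((pderiv ^^ n) ([:0, -1, 1:] ^ n))"

definition legendre_coeff :: "real \<Rightarrow> nat \<Rightarrow> (real \<Rightarrow> real ^ 'm) \<Rightarrow> real ^ 'm" where
  "legendre_coeff h j w = integral {0..1} (\<lambda>\<zeta>. poly (legendre01 j) \<zeta> *\<^sub>R w (\<zeta> * h))"

definition gauss_nodes :: "nat \<Rightarrow> (nat \<Rightarrow> real) \<Rightarrow> bool" where
  "gauss_nodes s c \<longleftrightarrow>
     strict_mono_on {1..s} c \<and> c ` {1..s} \<subseteq> {0<..<1} \<and>
     c ` {1..s} = {x. poly (legendre01 s) x = 0}"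

definition lagrange_basis :: "nat \<Rightarrow> (nat \<Rightarrow> real) \<Rightarrow> nat \<Rightarrow> real \<Rightarrow> real" where
  "lagrange_basis s c j x = (\<Prod>i\<in>{1..s} - {j}. (x - c i) / (c j - c i))"

lemma degree_legendre01: "degree (legendre01 n) = n"
proof -
  have "2 * real n + 1 \<noteq> 0" by linarith
  then have "sqrt (2 * real n + 1) / fact n \<noteq> 0" by simp
  then have "degree (legendre01 n) = degree ((pderiv ^^ n) ([:0, -1, 1::real:] ^ n))"
    unfolding legendre01_def by (rule degree_smult_eq[THEN trans, OF if_not_P])
  also have "\<dots> = degree ([:0, -1, 1::real:] ^ n) - n"
    by (rule degree_higher_pderiv)
  also have "degree ([:0, -1, 1::real:] ^ n) = 2 * n"
    by (simp add: degree_power_eq)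
  finally show ?thesis by simp
qed

lemma integral_pderiv_unit:
  fixes p :: "real poly"
  shows "integral {0..1} (poly (pderiv p)) = poly p 1 - poly p 0"
proof (intro integral_unique fundamental_theorem_of_calculus)
  fix x :: real
  show "(poly p has_vector_derivative poly (pderiv p) x) (at x within {0..1})"
    using poly_DERIV[of p x]
    by (simp add: has_real_derivative_iff_has_vector_derivative has_vector_derivative_at_within)
qed simp

lemma poly_integrable_unit: "poly p integrable_on {0..1::real}"
  by (intro integrable_continuous_interval continuous_intros)

lemma integral_by_parts_unit:
  fixes p q :: "real poly"
  assumes "poly p 0 = 0" "poly p 1 = 0"
  shows "integral {0..1} (poly (pderiv p * q)) = - integral {0..1} (poly (p * pderiv q))"
proof -
  have "integral {0..1} (poly (pderiv p * q)) + integral {0..1} (poly (p * pderiv q))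
      = integral {0..1} (\<lambda>x. poly (pderiv p * q) x + poly (p * pderiv q) x)"
    by (rule Henstock_Kurzweil_Integration.integral_add[symmetric]) (rule poly_integrable_unit)+
  also have "(\<lambda>x. poly (pderiv p * q) x + poly (p * pderiv q) x) = poly (pderiv (p * q))"
    by (auto simp: pderiv_mult fun_eq_iff algebra_simps)
  also have "integral {0..1} \<dots> = 0"
    using assms by (simp add: integral_pderiv_unit)
  finally show ?thesis by linarith
qed

lemma power_dvd_higher_pderiv:
  fixes w :: "real poly"
  assumes "k \<le> n"
  shows "w ^ (n - k) dvd (pderiv ^^ k) (w ^ n)"
  using assms
proof (induction k)
  case (Suc k)
  then obtain r where r: "(pderiv ^^ k) (w ^ n) = w ^ (n - k) * r"
    unfolding dvd_def by auto
  have "n - k = Suc (n - Suc k)" using Suc.prems by simp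
  then have "(pderiv ^^ k) (w ^ n) = w ^ Suc (n - Suc k) * r" using r by simp
  then have "(pderiv ^^ Suc k) (w ^ n)
      = w ^ Suc (n - Suc k) * pderiv r + r * (smult (of_nat (Suc (n - Suc k))) (w ^ (n - Suc k)) * pderiv w)"
    by (simp only: funpow.simps comp_apply pderiv_mult pderiv_power_Suc)
  also have "\<dots> = w ^ (n - Suc k) * (w * pderiv r + smult (of_nat (Suc (n - Suc k))) (pderiv w) * r)"
    by (simp add: algebra_simps del: of_nat_Suc)
  finally have "(pderiv ^^ Suc k) (w ^ n)
      = w ^ (n - Suc k) * (w * pderiv r + smult (of_nat (Suc (n - Suc k))) (pderiv w) * r)" .
  then show ?case by (metis dvd_triv_left)
qed simp

lemma integral_rodrigues:
  fixes q :: "real poly"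
  defines "W \<equiv> \<lambda>n. [:0, -1, 1::real:] ^ n"
  assumes "k \<le> n"
  shows "integral {0..1} (poly ((pderiv ^^ n) (W n) * q))
       = (-1) ^ k * integral {0..1} (poly ((pderiv ^^ (n - k)) (W n) * (pderiv ^^ k) q))"
  using assms(2)
proof (induction k)
  case (Suc k)
  have "n - k = Suc (n - Suc k)" using Suc.prems by simp
  then have 1: "(pderiv ^^ (n - k)) (W n) = pderiv ((pderiv ^^ (n - Suc k)) (W n))" by simp
  have "[:0, -1, 1::real:] ^ (n - (n - Suc k)) dvd (pderiv ^^ (n - Suc k)) (W n)"
    unfolding W_def by (rule power_dvd_higher_pderiv) simp
  then obtain r where "(pderiv ^^ (n - Suc k)) (W n) = [:0, -1, 1::real:] ^ (n - (n - Suc k)) * r"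
    unfolding dvd_def by auto
  moreover have "n - (n - Suc k) > 0" using Suc.prems by simp
  ultimately have "poly ((pderiv ^^ (n - Suc k)) (W n)) 0 = 0"
      "poly ((pderiv ^^ (n - Suc k)) (W n)) 1 = 0"
    by auto
  from integral_by_parts_unit[OF this, of "(pderiv ^^ k) q"] show ?case
    using Suc by (simp add: 1 del: poly_mult)
qed simp

lemma integral_unit_power:
  "integral {0..1} (poly ([:0, 1::real:] ^ a * [:-1, 1:] ^ b))
     = (-1) ^ b * fact a * fact b / fact (a + b + 1)"
proof (induction b arbitrary: a)
  case 0
  have "pderiv (smult (1 / (real a + 1)) ([:0, 1::real:] ^ Suc a)) = [:0, 1:] ^ a"
    by (simp add: pderiv_smult pderiv_power_Suc pderiv_pCons add.commute[of 1] del: power_Suc)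
  from integral_pderiv_unit[of "smult (1 / (real a + 1)) ([:0, 1::real:] ^ Suc a)", unfolded this]
  have "integral {0..1} (poly ([:0, 1::real:] ^ a)) = 1 / (real a + 1)" by simp
  moreover have "fact a / fact (a + 1) = 1 / (real a + 1)"
    by (simp add: divide_simps)
  ultimately show ?case by (simp del: poly_power)
next
  case (Suc b)
  let ?x = "[:0, 1::real:]" and ?y = "[:-1, 1::real:]"
  let ?I = "\<lambda>p :: real poly. integral {0..1} (poly p)"
  have px: "pderiv (?x ^ Suc a) = smult (real (Suc a)) (?x ^ a)"
    and py: "pderiv (?y ^ Suc b) = smult (real (Suc b)) (?y ^ b)"
    by (simp_all add: pderiv_power_Suc pderiv_pCons del: power_Suc of_nat_Suc)
  have deriv: "pderiv (?x ^ Suc a * ?y ^ Suc b)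
      = smult (real (Suc a)) (?x ^ a * ?y ^ Suc b) + smult (real (Suc b)) (?x ^ Suc a * ?y ^ b)"
    unfolding pderiv_mult px py by (simp add: algebra_simps del: power_Suc of_nat_Suc)
  have zero: "?I (pderiv (?x ^ Suc a * ?y ^ Suc b)) = 0"
    unfolding integral_pderiv_unit by simp
  have lin: "?I (smult r p + smult r' p') = r * ?I p + r' * ?I p'" for r r' p p'
  proof -
    have "poly (smult r p + smult r' p') = (\<lambda>x. r * poly p x + r' * poly p' x)"
      by (simp add: fun_eq_iff)
    moreover have int: "(\<lambda>x. k * poly f x) integrable_on {0..1}" for k :: real and f
      using poly_integrable_unit by (rule integrable_on_mult_right)
    moreover have "integral {0..1} (\<lambda>x. r * poly p x + r' * poly p' x)
        = integral {0..1} (\<lambda>x. r * poly p x) + integral {0..1} (\<lambda>x. r' * poly p' x)"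
      by (intro Henstock_Kurzweil_Integration.integral_add int)
    ultimately show ?thesis by simp
  qed
  have "real (Suc a) * ?I (?x ^ a * ?y ^ Suc b) = - (real (Suc b) * ?I (?x ^ Suc a * ?y ^ b))"
    using zero unfolding deriv lin by linarith
  also have "?I (?x ^ Suc a * ?y ^ b) = (-1) ^ b * fact (Suc a) * fact b / fact (Suc a + b + 1)"
    by (rule Suc)
  finally have "real (Suc a) * ?I (?x ^ a * ?y ^ Suc b) =
      real (Suc a) * ((-1) ^ Suc b * fact a * fact (Suc b) / fact (a + Suc b + 1))"
    unfolding fact_Suc[of a] fact_Suc[of b] add_Suc add_Suc_right
    by (simp add: power_Suc[of "- 1 :: real"] ac_simps
        del: fact_Suc of_nat_Suc power_Suc poly_mult poly_power mult_pCons_left mult_pCons_right)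
  then show ?case by (metis mult_left_cancel of_nat_neq_0)
qed

lemma legendre01_orthonormal:
  "integral {0..1} (\<lambda>x. poly (legendre01 i) x * poly (legendre01 j) x) = (if i = j then 1 else 0)"
proof -
  have lower: "integral {0..1} (\<lambda>x. poly (legendre01 n) x * poly q x) = 
      sqrt (2 * real n + 1) / fact n * (-1) ^ n *
        integral {0..1} (poly ([:0, -1, 1:] ^ n * (pderiv ^^ n) q))" for n q
  proof -
    have "(\<lambda>x. poly (legendre01 n) x * poly q x) =
        (\<lambda>x. sqrt (2 * real n + 1) / fact n * poly ((pderiv ^^ n) ([:0, -1, 1:] ^ n) * q) x)"
      by (simp add: legendre01_def fun_eq_iff)
    then show ?thesis
      using integral_rodrigues[of n n q] by (simp del: poly_mult)
  qed
  have zero: "integral {0..1} (\<lambda>x. poly (legendre01 n) x * poly (legendre01 k) x) = 0" if "k < n" for n k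
  proof -
    have "(pderiv ^^ n) (legendre01 k) = 0"
      using that by (intro poly_eqI) (simp add: coeff_higher_pderiv coeff_eq_0 degree_legendre01)
    moreover have "poly 0 = (\<lambda>x::real. 0::real)" by (simp add: fun_eq_iff)
    ultimately show ?thesis unfolding lower by simp
  qed
  have one: "integral {0..1} (\<lambda>x. poly (legendre01 n) x * poly (legendre01 n) x) = 1" for n
  proof -
    let ?W = "[:0, -1, 1::real:]" and ?k = "sqrt (2 * real n + 1) / fact n"
    have deg: "degree (?W ^ n) = n + n" by (simp add: degree_power_eq)
    have "lead_coeff (?W ^ n) = 1" by (simp add: lead_coeff_power)
    then have lc: "coeff (?W ^ n) (n + n) = 1" by (simp only: deg)
    have "(pderiv ^^ (n + n)) (?W ^ n) = [:fact (n + n):]"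
    proof (rule poly_eqI)
      fix i show "coeff ((pderiv ^^ (n + n)) (?W ^ n)) i = coeff [:fact (n + n):] i"
        using lc by (cases i) (simp_all add: coeff_higher_pderiv pochhammer_fact coeff_eq_0 deg)
    qed
    then have D: "(pderiv ^^ n) (legendre01 n) = [:?k * fact (n + n):]"
      by (simp add: legendre01_def higher_pderiv_smult funpow_add)
    have "?W = [:0, 1:] * [:-1, 1:]" by simp
    then have "?W ^ n = [:0, 1:] ^ n * [:-1, 1:] ^ n" by (metis power_mult_distrib)
    then have I: "integral {0..1} (poly (?W ^ n)) = (-1) ^ n * fact n * fact n / fact (n + n + 1)"
      using integral_unit_power[of n n] by simp
    have "integral {0..1} (poly (?W ^ n * (pderiv ^^ n) (legendre01 n)))
        = integral {0..1} (\<lambda>x. ?k * fact (n + n) * poly (?W ^ n) x)"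
      unfolding D by (intro arg_cong[of _ _ "integral {0..1}"]) (auto simp: fun_eq_iff)
    also have "\<dots> = ?k * fact (n + n) * integral {0..1} (poly (?W ^ n))"
      by (rule integral_mult_right)
    finally have "integral {0..1} (\<lambda>x. poly (legendre01 n) x * poly (legendre01 n) x)
       = ?k * (-1) ^ n * (?k * fact (n + n) * ((-1) ^ n * fact n * fact n / fact (n + n + 1)))"
      unfolding lower I by (simp only: mult.assoc)
    also have "\<dots> = ((-1) ^ n * (-1) ^ n) * (sqrt (2 * real n + 1) * sqrt (2 * real n + 1))
        * (fact (n + n) / fact (n + n + 1))"
    proof -
      have "r / w * e * (r / w * F * (e * w * w / G)) = (e * e) * (r * r) * (F / G)"
        if "w \<noteq> 0" for r w e F G :: real
        using that by simp
      from this[OF fact_nonzero] show ?thesis .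
    qed
    also have "(-1::real) ^ n * (-1) ^ n = 1" by (simp flip: power_mult_distrib)
    also have "sqrt (2 * real n + 1) * sqrt (2 * real n + 1) = 2 * real n + 1" by simp
    also have "fact (n + n + 1) = (2 * real n + 1) * fact (n + n)"
      by (simp add: algebra_simps)
    also have "1 * (2 * real n + 1) * (fact (n + n) / ((2 * real n + 1) * fact (n + n))) = 1"
    proof -
      have "2 * real n + 1 \<noteq> 0" by linarith
      then show ?thesis by simp
    qed
    finally show ?thesis .
  qed
  show ?thesis
    using zero[of i j] zero[of j i] one[of i]
    by (cases i j rule: linorder_cases) (simp_all add: mult.commute)
qed

end

theory Submission
  imports Defs
begin

text \<open>
  Along the numerical solution the energy changes at the rate
  \<open>v' \<bullet> M\<^sup>-\<^sup>1 v - u' \<bullet> \<nabla>U(u)\<close>. Write \<open>\<pi>\<close> for the \<open>L\<^sup>2\<close>-orthogonal projection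
  onto polynomials of degree less than \<open>s\<close>. The method replaces the exact right-hand sides by
  \<open>u' = M\<^sup>-\<^sup>1 \<pi> v\<close> and \<open>v' = \<pi>(\<nabla>U \<circ> u) - R\<close>, where \<open>R\<close> is the polynomial of degree less
  than \<open>s\<close> that interpolates the constraint forces \<open>\<nabla>g(u) \<lambda>\<close> at the Gauss nodes. The energy
  balance over the step is therefore \<open>h\<close> times the integral over the unit interval of
  \<open>\<pi>(\<nabla>U \<circ> u) \<bullet> M\<^sup>-\<^sup>1 v - M\<^sup>-\<^sup>1 \<pi> v \<bullet> (\<nabla>U \<circ> u) - R \<bullet> M\<^sup>-\<^sup>1 v\<close>.

  The first two terms cancel: \<open>\<pi>\<close> is self-adjoint, it commutes with the constant matrix
  \<open>M\<^sup>-\<^sup>1\<close>, and \<open>M\<^sup>-\<^sup>1\<close> is symmetric. Concretely both integrals equal the same finite sum of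
  inner products of Legendre coefficients (\<open>legendre_projection_inner_has_integral\<close>).

  The third term vanishes by Gauss quadrature: \<open>R \<bullet> M\<^sup>-\<^sup>1 v\<close> is a polynomial of degree at most
  \<open>(s - 1) + s = 2 s - 1\<close>, and at each node it is the power of the constraint force,
  \<open>\<lambda>\<^sub>i \<bullet> \<nabla>g(u)\<^sup>T M\<^sup>-\<^sup>1 v = 0\<close>. A polynomial of that degree that vanishes at the
  \<open>s\<close> Gauss nodes has integral zero (\<open>integral_eq_0_if_zero_at_gauss_nodes\<close>).

  The Legendre coefficients of \<open>\<nabla>U \<circ> u\<close> are meaningful only if this function is integrable.
  Hence the first step is analytic: the sum of a power series in several variables has a
  continuous gradient (\<open>real_analytic_continuous_gradient_locally\<close>).
\<close>

section \<open>Inverses of symmetric matrices\<close>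

lemma matrix_inv_sym_pos_def_self_adjoint:
  fixes M :: "real ^ 'm ^ 'm"
  assumes "sym_pos_def M"
  shows "(matrix_inv M *v x) \<bullet> y = x \<bullet> (matrix_inv M *v y)"
proof -
  have sym: "(M *v a) \<bullet> b = a \<bullet> (M *v b)" for a b
    using assms unfolding sym_pos_def_def
    by (metis dot_lmul_matrix transpose_matrix_vector)
  have "a = 0" if "M *v a = 0" for a
    using assms that unfolding sym_pos_def_def by (metis inner_zero_right less_irrefl)
  then have "invertible M"
    by (simp add: invertible_left_inverse matrix_left_invertible_ker)
  then have "M ** matrix_inv M = mat 1"
    unfolding invertible_def matrix_inv_def by (metis (mono_tags, lifting) someI_ex)
  then have M_inv: "M *v (matrix_inv M *v z) = z" for z
    by (simp add: matrix_vector_mul_assoc)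
  show ?thesis
    using sym[of "matrix_inv M *v x" "matrix_inv M *v y"] by (simp add: M_inv)
qed

section \<open>Gradients of real analytic functions\<close>

lemma grad_eqI: "GDERIV f x :> d \<Longrightarrow> grad f x = d"
proof -
  assume d: "GDERIV f x :> d"
  have "e = d" if "GDERIV f x :> e" for e
  proof -
    have "(\<lambda>h. h \<bullet> e) = (\<lambda>h. h \<bullet> d)"
      using that d unfolding gderiv_def by (rule has_derivative_unique)
    then have "(e - d) \<bullet> (e - d) = 0"
      by (metis inner_diff_right right_minus_eq)
    then show ?thesis by simp
  qed
  with d show ?thesis unfolding grad_def by (intro the_equality)
qed

definition monomial :: "('m::finite \<Rightarrow> nat) \<Rightarrow> real ^ 'm \<Rightarrow> real" where
  "monomial \<alpha> z = (\<Prod>i\<in>UNIV. (z $ i) ^ \<alpha> i)"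

definition monomial_grad :: "('m::finite \<Rightarrow> nat) \<Rightarrow> real ^ 'm \<Rightarrow> real ^ 'm" where
  "monomial_grad \<alpha> z =
     (\<chi> j. (real (\<alpha> j) * (z $ j) ^ (\<alpha> j - 1)) * (\<Prod>i\<in>UNIV - {j}. (z $ i) ^ \<alpha> i))"

lemma monomial_has_derivative:
  "((\<lambda>y. monomial \<alpha> (y - x)) has_derivative (\<lambda>h. h \<bullet> monomial_grad \<alpha> (y - x))) (at y within S)"
proof -
  have "((\<lambda>y. (y $ i - x $ i) ^ \<alpha> i) has_derivative
      (\<lambda>h. h $ i * (real (\<alpha> i) * (y $ i - x $ i) ^ (\<alpha> i - 1)))) (at y within S)" for i
    by (auto intro!: derivative_eq_intros bounded_linear.has_derivative[OF bounded_linear_vec_nth]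
        simp: fun_eq_iff)
  from has_derivative_prod[of UNIV, OF this] show ?thesis
    unfolding monomial_def monomial_grad_def
    by (simp add: inner_vec_def mult.assoc)
qed

lemma continuous_on_monomial_grad: "continuous_on S (\<lambda>y. monomial_grad \<alpha> (y - x))"
  unfolding monomial_grad_def
  by (intro continuous_intros)

text \<open>
  Halving the radius pays for the exponents that differentiation brings down, because
  \<open>k / 2^k \<le> 1\<close>. So the gradients of the monomials on a ball are dominated, up to a constant, by
  the values of the monomials at the corner of a cube of twice the size. Absolute convergence of a
  power series at that corner then controls the series of gradients.
\<close>

lemma norm_monomial_grad_le:
  fixes z :: "real ^ 'm"
  assumes "\<rho> > 0" and z: "norm z \<le> \<rho> / 2"
  shows "norm (monomial_grad \<alpha> z) \<le> real CARD('m) * (2 / \<rho>) * (\<Prod>i\<in>UNIV. \<rho> ^ \<alpha> i)"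
proof -
  have zi: "\<bar>z $ i\<bar> \<le> \<rho> / 2" for i
    using component_le_norm_cart[of z i] z by linarith
  have single: "real k * \<bar>z $ j\<bar> ^ (k - 1) \<le> 2 / \<rho> * \<rho> ^ k" for k j
  proof (cases k)
    case (Suc l)
    have "real k \<le> 2 ^ k" by (simp add: of_nat_less_two_power less_imp_le)
    then have "real k * \<bar>z $ j\<bar> ^ l \<le> 2 ^ k * (\<rho> / 2) ^ l"
      by (intro mult_mono power_mono zi) auto
    also have "\<dots> = 2 / \<rho> * \<rho> ^ k"
      using \<open>\<rho> > 0\<close> by (simp add: Suc field_simps)
    finally show ?thesis by (simp add: Suc)
  qed (use \<open>\<rho> > 0\<close> in auto)
  have "\<bar>monomial_grad \<alpha> z $ j\<bar> \<le> 2 / \<rho> * (\<Prod>i\<in>UNIV. \<rho> ^ \<alpha> i)" for j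
  proof -
    have "\<bar>monomial_grad \<alpha> z $ j\<bar>
        = (real (\<alpha> j) * \<bar>z $ j\<bar> ^ (\<alpha> j - 1)) * (\<Prod>i\<in>UNIV - {j}. \<bar>z $ i\<bar> ^ \<alpha> i)"
      by (simp add: monomial_grad_def abs_mult power_abs abs_prod)
    also have "\<dots> \<le> (2 / \<rho> * \<rho> ^ \<alpha> j) * (\<Prod>i\<in>UNIV - {j}. \<rho> ^ \<alpha> i)"
    proof (rule mult_mono[OF single])
      have "\<bar>z $ i\<bar> \<le> \<rho>" for i using zi[of i] \<open>\<rho> > 0\<close> by linarith
      then show "(\<Prod>i\<in>UNIV - {j}. \<bar>z $ i\<bar> ^ \<alpha> i) \<le> (\<Prod>i\<in>UNIV - {j}. \<rho> ^ \<alpha> i)"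
        by (intro prod_mono conjI power_mono) auto
    qed (use \<open>\<rho> > 0\<close> in \<open>auto intro: prod_nonneg\<close>)
    also have "\<dots> = 2 / \<rho> * (\<Prod>i\<in>UNIV. \<rho> ^ \<alpha> i)"
      by (simp add: prod.remove[of UNIV j])
    finally show ?thesis .
  qed
  then have "(\<Sum>j\<in>UNIV. \<bar>monomial_grad \<alpha> z $ j\<bar>) \<le> real CARD('m) * (2 / \<rho> * (\<Prod>i\<in>UNIV. \<rho> ^ \<alpha> i))"
    by (intro sum_bounded_above)
  with norm_le_l1_cart[of "monomial_grad \<alpha> z"] show ?thesis
    by (simp add: mult.assoc)
qed

text \<open>
  Termwise differentiation is about sums over the natural numbers; unconditional convergence allows
  any enumeration of the multi-indices.
\<close>

lemma multi_index_enumeration: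
  obtains e :: "nat \<Rightarrow> 'm::finite \<Rightarrow> nat" where "bij e"
proof
  have "infinite (UNIV :: ('m \<Rightarrow> nat) set)"
    by (simp add: finite_UNIV_fun)
  then show "bij (from_nat_into (UNIV :: ('m \<Rightarrow> nat) set))"
    by (intro bij_betw_from_nat_into) auto
qed

text \<open>
  The series converges absolutely at the corner \<open>(\<rho>, \<dots>, \<rho>)\<close> of a small cube around the centre.
  By \<open>norm_monomial_grad_le\<close> this majorises the series of gradients on the ball of radius
  \<open>\<rho> / 2\<close>. Uniform convergence then gives both termwise differentiability and continuity of the
  gradient.
\<close>

lemma real_analytic_continuous_gradient_locally:
  fixes f :: "real ^ 'm \<Rightarrow> real"
  assumes "real_analytic_on f D" "x \<in> D"
  obtains R G where "R > 0" "continuous_on (ball x R) G" "\<And>y. y \<in> ball x R \<Longrightarrow> GDERIV f y :> G y"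
proof -
  obtain r a where "r > 0"
    and f_sum: "\<And>y. y \<in> ball x r \<Longrightarrow> ((\<lambda>\<alpha>. a \<alpha> * monomial \<alpha> (y - x)) has_sum f y) UNIV"
    using assms unfolding real_analytic_on_def monomial_def by (auto simp: Ball_def) blast
  obtain e :: "nat \<Rightarrow> 'm \<Rightarrow> nat" where e: "bij e" by (rule multi_index_enumeration)
  \<comment> \<open>The corner has Euclidean norm at most \<open>CARD('m) * \<rho>\<close>; the \<open>+ 1\<close> makes this less than \<open>r\<close>.\<close>
  define \<rho> where "\<rho> = r / (real CARD('m) + 1)"
  define y\<^sub>0 where "y\<^sub>0 = x + (\<chi> i. \<rho>)"
  have "\<rho> > 0" using \<open>r > 0\<close> by (simp add: \<rho>_def add_pos_nonneg)
  have \<rho>_r: "real CARD('m) * \<rho> < r" using \<open>r > 0\<close> by (simp add: \<rho>_def field_simps)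
  have "norm (y\<^sub>0 - x) \<le> real CARD('m) * \<rho>"
    using norm_le_l1_cart[of "y\<^sub>0 - x"] \<open>\<rho> > 0\<close> by (simp add: y\<^sub>0_def)
  then have "y\<^sub>0 \<in> ball x r" using \<rho>_r by (simp add: dist_norm norm_minus_commute)
  from f_sum[OF this] have "(\<lambda>\<alpha>. norm (a \<alpha> * monomial \<alpha> (y\<^sub>0 - x))) summable_on UNIV"
    by (metis has_sum_imp_summable summable_on_iff_abs_summable_on_real)
  moreover have "norm (a \<alpha> * monomial \<alpha> (y\<^sub>0 - x)) = \<bar>a \<alpha>\<bar> * (\<Prod>i\<in>UNIV. \<rho> ^ \<alpha> i)" for \<alpha>
    using \<open>\<rho> > 0\<close> by (simp add: monomial_def y\<^sub>0_def abs_mult abs_prod)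
  ultimately have "(\<lambda>\<alpha>. \<bar>a \<alpha>\<bar> * (\<Prod>i\<in>UNIV. \<rho> ^ \<alpha> i)) summable_on UNIV" by simp
  then have "(\<lambda>n. \<bar>a (e n)\<bar> * (\<Prod>i\<in>UNIV. \<rho> ^ e n i)) summable_on UNIV"
    using summable_on_reindex_bij_betw[OF e] by fast
  then have "summable (\<lambda>n. \<bar>a (e n)\<bar> * (\<Prod>i\<in>UNIV. \<rho> ^ e n i))"
    by (rule summable_on_imp_summable)
  then have majorant: "summable (\<lambda>n. real CARD('m) * (2 / \<rho>) * (\<bar>a (e n)\<bar> * (\<Prod>i\<in>UNIV. \<rho> ^ e n i)))"
    by (rule summable_mult)
  define S where "S = ball x (\<rho> / 2)"
  define F where "F n y = a (e n) *\<^sub>R monomial_grad (e n) (y - x)" for n y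
  define G where "G y = (\<Sum>n. F n y)" for y
  have "\<rho> \<le> real CARD('m) * \<rho>"
    using \<open>\<rho> > 0\<close> by (simp add: Suc_le_eq)
  then have S_sub: "S \<subseteq> ball x r" unfolding S_def using \<rho>_r \<open>\<rho> > 0\<close> by (intro subset_ball) linarith
  have F_bound: "norm (F n y) \<le> real CARD('m) * (2 / \<rho>) * (\<bar>a (e n)\<bar> * (\<Prod>i\<in>UNIV. \<rho> ^ e n i))"
    if "y \<in> S" for n y
  proof -
    have "norm (y - x) \<le> \<rho> / 2" using that by (simp add: S_def dist_norm norm_minus_commute)
    from mult_left_mono[OF norm_monomial_grad_le[OF \<open>\<rho> > 0\<close> this, of "e n"] abs_ge_zero[of "a (e n)"]]
    show ?thesis by (simp add: F_def mult_ac)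
  qed
  have unif: "uniform_limit S (\<lambda>N y. \<Sum>n<N. F n y) G sequentially"
    unfolding G_def by (rule Weierstrass_m_test[OF F_bound majorant])
  have G_cont: "continuous_on S G"
    by (rule uniform_limit_theorem[OF _ unif])
      (auto simp: F_def intro!: always_eventually continuous_intros continuous_on_monomial_grad)
  have f_sums: "(\<lambda>n. a (e n) * monomial (e n) (y - x)) sums f y" if "y \<in> S" for y
    using f_sum[of y] S_sub that
      has_sum_reindex_bij_betw[OF e, of "\<lambda>\<alpha>. a \<alpha> * monomial \<alpha> (y - x)"]
    by (intro has_sum_imp_sums) blast
  have x_S: "x \<in> S" using \<open>\<rho> > 0\<close> by (simp add: S_def)
  have "\<exists>g. \<forall>y\<in>S. (\<lambda>n. a (e n) * monomial (e n) (y - x)) sums g y \<and>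
      (g has_derivative (\<lambda>h. h \<bullet> G y)) (at y within S)"
  proof (rule has_derivative_series)
    show "x \<in> S" "(\<lambda>n. a (e n) * monomial (e n) (x - x)) sums f x"
      by (fact x_S, rule f_sums[OF x_S])
    show "convex S" by (simp add: S_def)
    show "((\<lambda>y. a (e n) * monomial (e n) (y - x)) has_derivative (\<lambda>h. h \<bullet> F n y)) (at y within S)"
      for n y
      unfolding F_def inner_scaleR_right
      by (rule has_derivative_mult_right[OF monomial_has_derivative])
    show "\<forall>\<^sub>F N in sequentially. \<forall>y\<in>S. \<forall>h. norm ((\<Sum>n<N. h \<bullet> F n y) - h \<bullet> G y) \<le> \<epsilon> * norm h"
      if "\<epsilon> > 0" for \<epsilon>
      using uniform_limitD[OF unif that]
    proof eventually_elim
      case (elim N)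
      show ?case
      proof (intro ballI allI)
        fix y h assume "y \<in> S"
        then have le: "norm ((\<Sum>n<N. F n y) - G y) \<le> \<epsilon>" using elim by (auto simp: dist_norm)
        have "norm ((\<Sum>n<N. h \<bullet> F n y) - h \<bullet> G y) = \<bar>h \<bullet> ((\<Sum>n<N. F n y) - G y)\<bar>"
          by (simp add: inner_diff_right inner_sum_right)
        also have "\<dots> \<le> norm h * norm ((\<Sum>n<N. F n y) - G y)" by (rule Cauchy_Schwarz_ineq2)
        also have "\<dots> \<le> norm h * \<epsilon>" by (intro mult_left_mono le) simp
        finally show "norm ((\<Sum>n<N. h \<bullet> F n y) - h \<bullet> G y) \<le> \<epsilon> * norm h" by (simp add: mult.commute)
      qed
    qed
  qed
  then obtain k where k: "\<And>y. y \<in> S \<Longrightarrow> (\<lambda>n. a (e n) * monomial (e n) (y - x)) sums k y"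
      "\<And>y. y \<in> S \<Longrightarrow> (k has_derivative (\<lambda>h. h \<bullet> G y)) (at y within S)" by blast
  have "GDERIV f y :> G y" if "y \<in> S" for y
  proof -
    have "open S" by (simp add: S_def)
    have "f z = k z" if "z \<in> S" for z using k(1) f_sums sums_unique2 that by blast
    then have "(f has_derivative (\<lambda>h. h \<bullet> G y)) (at y within S)"
      by (rule has_derivative_transform[OF that _ k(2)[OF that]])
    then show ?thesis
      unfolding gderiv_def using at_within_open[OF that \<open>open S\<close>] by simp
  qed
  then show ?thesis
    using that[of "\<rho> / 2" G] \<open>\<rho> > 0\<close> G_cont unfolding S_def by auto
qed

lemma real_analytic_on_GDERIV:
  assumes "real_analytic_on f D" "x \<in> D"
  shows "GDERIV f x :> grad f x"
proof -
  obtain R G where "R > 0" "\<And>y. y \<in> ball x R \<Longrightarrow> GDERIV f y :> G y"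
    using real_analytic_continuous_gradient_locally[OF assms] by metis
  then have "GDERIV f x :> G x" by simp
  then show ?thesis by (simp add: grad_eqI)
qed

lemma real_analytic_on_continuous_grad:
  assumes "real_analytic_on f D"
  shows "continuous_on D (grad f)"
proof (rule continuous_at_imp_continuous_on, rule ballI)
  fix x assume "x \<in> D"
  then obtain R G where R: "R > 0" "continuous_on (ball x R) G"
    "\<And>y. y \<in> ball x R \<Longrightarrow> GDERIV f y :> G y"
    using real_analytic_continuous_gradient_locally[OF assms] by metis
  then have "continuous_on (ball x R) (grad f)"
    using grad_eqI by (metis continuous_on_cong)
  then show "isCont (grad f) x"
    using R(1) by (simp add: continuous_on_eq_continuous_at)
qed

section \<open>Gauss quadrature\<close>

lemma integral_legendre01_times_lower_degree:
  assumes "degree q < n"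
  shows "integral {0..1} (poly (legendre01 n * q)) = 0"
proof -
  have zero: "(pderiv ^^ n) q = 0"
    using assms by (intro poly_eqI) (simp add: coeff_higher_pderiv coeff_eq_0)
  let ?k = "sqrt (2 * real n + 1) / fact n"
  have "poly (legendre01 n * q) = (\<lambda>x. ?k * poly ((pderiv ^^ n) ([:0, -1, 1:] ^ n) * q) x)"
    by (simp add: legendre01_def fun_eq_iff)
  moreover have "poly 0 = (\<lambda>x::real. 0::real)" by (simp add: fun_eq_iff)
  ultimately show ?thesis
    using integral_rodrigues[of n n q] by (simp add: zero del: poly_mult)
qed

lemma gauss_nodes_inj: "gauss_nodes s c \<Longrightarrow> inj_on c {1..s}"
  unfolding gauss_nodes_def by (blast intro: strict_mono_on_imp_inj_on)

text \<open>
  Exactness of Gauss quadrature, in the form in which no weights appear. Having all \<open>s\<close> nodes as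
  zeros makes \<open>p\<close> a multiple of the Legendre polynomial of degree \<open>s\<close>; the cofactor has degree less
  than \<open>s\<close>, and the Legendre polynomial is orthogonal to it.
\<close>

lemma integral_eq_0_if_zero_at_gauss_nodes:
  assumes c: "gauss_nodes s c"
    and deg: "degree p < 2 * s"
    and zero: "\<And>i. i \<in> {1..s} \<Longrightarrow> poly p (c i) = 0"
  shows "integral {0..1} (poly p) = 0"
proof -
  let ?L = "legendre01 s"
  have s: "0 < s" using deg by simp
  have L0: "?L \<noteq> 0" using s by (metis degree_0 degree_legendre01 less_irrefl)
  \<comment> \<open>The remainder inherits the \<open>s\<close> zeros but has degree less than \<open>s\<close>.\<close>
  have "p mod ?L = 0"
  proof (rule ccontr)
    assume ne: "p mod ?L \<noteq> 0"
    then have lt: "degree (p mod ?L) < s"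
      using degree_mod_less'[OF L0] by (simp add: degree_legendre01)
    have "poly (p mod ?L) (c i) = 0" if "i \<in> {1..s}" for i
    proof -
      have "poly ?L (c i) = 0" using c that unfolding gauss_nodes_def by blast
      with zero[OF that] have "poly (p - ?L * (p div ?L)) (c i) = 0" by simp
      then show ?thesis by (simp only: minus_mult_div_eq_mod)
    qed
    then have "c ` {1..s} \<subseteq> {x. poly (p mod ?L) x = 0}" by blast
    from card_mono[OF poly_roots_finite[OF ne] this]
    have "s \<le> card {x. poly (p mod ?L) x = 0}"
      using gauss_nodes_inj[OF c] by (simp add: card_image)
    with card_poly_roots_bound[OF ne] lt show False by linarith
  qed
  then obtain q where p: "p = ?L * q" by (auto simp: mod_eq_0_iff_dvd)
  show ?thesis
  proof (cases "q = 0")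
    case True
    have "poly 0 = (\<lambda>x::real. 0::real)" by (simp add: fun_eq_iff)
    then show ?thesis by (simp add: p True)
  next
    case False
    then have "degree p = s + degree q"
      using L0 by (simp add: p degree_mult_eq degree_legendre01)
    then show ?thesis
      using deg unfolding p by (intro integral_legendre01_times_lower_degree) linarith
  qed
qed

section \<open>Polynomial curves and interpolated forces\<close>

lemma lagrange_basis_poly:
  assumes "j \<in> {1..s}"
  obtains L where "degree L < s" "poly L = lagrange_basis s c j"
proof
  let ?L = "\<Prod>i\<in>{1..s} - {j}. smult (1 / (c j - c i)) [:- c i, 1:]"
  show "poly ?L = lagrange_basis s c j"
    by (simp add: fun_eq_iff lagrange_basis_def poly_prod diff_divide_distrib)
  have "degree ?L \<le> (\<Sum>i\<in>{1..s} - {j}. degree (smult (1 / (c j - c i)) [:- c i, 1:]))"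
    by (rule order_trans[OF degree_prod_sum_le]) (simp_all add: o_def del: smult_pCons)
  also have "\<dots> \<le> (\<Sum>i\<in>{1..s} - {j}. 1)"
    by (intro sum_mono) simp
  also have "\<dots> < s" using assms by simp
  finally show "degree ?L < s" .
qed

lemma lagrange_basis_eq_0:
  assumes "i \<in> {1..s}" "i \<noteq> j"
  shows "lagrange_basis s c j (c i) = 0"
  unfolding lagrange_basis_def using assms by (intro prod_zero) auto

lemma polynomial_curve_component:
  fixes w :: "real \<Rightarrow> 'a::real_inner"
  assumes "polynomial_curve s w"
  obtains p :: "real poly" where "degree p \<le> s" "\<And>x. poly p x = b \<bullet> w (x * h)"
proof -
  obtain a where a: "\<And>t. w t = (\<Sum>k\<le>s. t ^ k *\<^sub>R a k)"
    using assms unfolding polynomial_curve_def by blast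
  show thesis
  proof
    show "degree (\<Sum>k\<le>s. monom (h ^ k * (b \<bullet> a k)) k) \<le> s"
      by (intro degree_sum_le) (auto intro: order_trans[OF degree_monom_le])
    show "poly (\<Sum>k\<le>s. monom (h ^ k * (b \<bullet> a k)) k) x = b \<bullet> w (x * h)" for x
      by (simp add: a poly_sum poly_monom inner_sum_right power_mult_distrib mult_ac)
  qed
qed

lemma polynomial_curve_linear_image:
  assumes "polynomial_curve s w" "linear f"
  shows "polynomial_curve s (\<lambda>t. f (w t))"
proof -
  obtain a where "\<And>t. w t = (\<Sum>k\<le>s. t ^ k *\<^sub>R a k)"
    using assms(1) unfolding polynomial_curve_def by blast
  then have "f (w t) = (\<Sum>k\<le>s. t ^ k *\<^sub>R f (a k))" for t
    by (simp add: linear_sum[OF assms(2)] linear_cmul[OF assms(2)])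
  then show ?thesis unfolding polynomial_curve_def by (intro exI[of _ "\<lambda>k. f (a k)"] allI)
qed

lemma polynomial_curve_continuous:
  fixes w :: "real \<Rightarrow> 'a::real_normed_vector"
  assumes "polynomial_curve s w"
  shows "continuous_on S w"
proof -
  obtain a where "w = (\<lambda>t. \<Sum>k\<le>s. t ^ k *\<^sub>R a k)"
    using assms unfolding polynomial_curve_def by fast
  then show ?thesis by (simp add: continuous_intros)
qed

text \<open>
  The work done, for a velocity \<open>w\<close>, by a force \<open>b\<close> that is applied at the single node \<open>c j\<close> and spread
  over the step by the Lagrange basis. The Lagrange factor kills the integrand at the other nodes and
  orthogonality kills it at \<open>c j\<close>, so Gauss quadrature sees only zeros.
\<close>

lemma lagrange_curve_has_integral_0:
  fixes w :: "real \<Rightarrow> 'a::real_inner"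
  assumes c: "gauss_nodes s c" and w: "polynomial_curve s w" and j: "j \<in> {1..s}"
    and zero: "b \<bullet> w (c j * h) = 0"
  shows "((\<lambda>x. lagrange_basis s c j x * (b \<bullet> w (x * h))) has_integral 0) {0..1}"
proof -
  obtain L where L: "degree L < s" "poly L = lagrange_basis s c j"
    using lagrange_basis_poly[OF j] .
  obtain p where p: "degree p \<le> s" "\<And>x. poly p x = b \<bullet> w (x * h)"
    using polynomial_curve_component[OF w, where b = b and h = h] by blast
  have "integral {0..1} (poly (L * p)) = 0"
  proof (rule integral_eq_0_if_zero_at_gauss_nodes[OF c])
    show "degree (L * p) < 2 * s"
      using degree_mult_le[of L p] L(1) p(1) by linarith
    show "poly (L * p) (c i) = 0" if "i \<in> {1..s}" for i
      using that zero by (cases "i = j") (auto simp: L p lagrange_basis_eq_0)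
  qed
  moreover have "poly (L * p) = (\<lambda>x. lagrange_basis s c j x * (b \<bullet> w (x * h)))"
    by (simp add: fun_eq_iff L p)
  ultimately show ?thesis
    using poly_integrable_unit[of "L * p"] by (simp add: has_integral_iff)
qed

section \<open>Self-adjointness of the Legendre projection\<close>

text \<open>
  If the \<open>z j\<close> are the Legendre coefficients of a second curve, the value of the integral is symmetric in
  the two curves; this is the self-adjointness of the projection. The coefficients are left arbitrary
  so that those of \<open>M\<^sup>-\<^sup>1 v\<close> can be entered already in the form \<open>M\<^sup>-\<^sup>1\<close> applied to those of \<open>v\<close>.
\<close>

lemma legendre_projection_inner_has_integral:
  fixes z :: "nat \<Rightarrow> real ^ 'm" and w :: "real \<Rightarrow> real ^ 'm"
  assumes "continuous_on {0..1} (\<lambda>x. w (x * h))"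
  shows "((\<lambda>x. (\<Sum>j<s. poly (legendre01 j) x *\<^sub>R z j) \<bullet> w (x * h)) has_integral
           (\<Sum>j<s. z j \<bullet> legendre_coeff h j w)) {0..1}"
proof -
  have "((\<lambda>x. z j \<bullet> (poly (legendre01 j) x *\<^sub>R w (x * h))) has_integral
          z j \<bullet> legendre_coeff h j w) {0..1}" for j
    unfolding legendre_coeff_def
    by (intro has_integral_linear[OF _ bounded_linear_inner_right, unfolded o_def]
        integrable_integral integrable_continuous_interval continuous_intros assms)
  then have "((\<lambda>x. \<Sum>j<s. z j \<bullet> (poly (legendre01 j) x *\<^sub>R w (x * h))) has_integral
           (\<Sum>j<s. z j \<bullet> legendre_coeff h j w)) {0..1}"
    by (intro has_integral_sum) auto
  then show ?thesis by (simp add: inner_sum_left)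
qed

lemma legendre_coeff_matrix:
  fixes A :: "real ^ 'm ^ 'm"
  assumes "continuous_on {0..1} (\<lambda>x. w (x * h))"
  shows "legendre_coeff h j (\<lambda>t. A *v w t) = A *v legendre_coeff h j w"
  unfolding legendre_coeff_def
  using integral_linear[of "\<lambda>x. poly (legendre01 j) x *\<^sub>R w (x * h)" "{0..1}" "(*v) A"]
  by (simp add: o_def matrix_vector_mul_bounded_linear matrix_vector_mult_scaleR
      integrable_continuous_interval continuous_intros assms)

section \<open>Energy conservation\<close>

lemma hamiltonian_has_vector_derivative:
  assumes M: "sym_pos_def M"
    and u: "(u has_vector_derivative u') (at t)" and v: "(v has_vector_derivative v') (at t)"
    and U: "GDERIV U (u t) :> d"
  shows "((\<lambda>t. hamiltonian M U (u t) (v t)) has_vector_derivative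
           (v' \<bullet> (matrix_inv M *v v t) - u' \<bullet> d)) (at t)"
proof -
  let ?N = "matrix_inv M"
  have Nv: "((\<lambda>t. ?N *v v t) has_vector_derivative ?N *v v') (at t)"
    by (rule bounded_linear.has_vector_derivative[OF matrix_vector_mul_bounded_linear v])
  have "((\<lambda>t. v t \<bullet> (?N *v v t)) has_vector_derivative v t \<bullet> (?N *v v') + v' \<bullet> (?N *v v t)) (at t)"
    by (rule bounded_bilinear.has_vector_derivative[OF bounded_bilinear_inner v Nv])
  moreover have "v t \<bullet> (?N *v v') = v' \<bullet> (?N *v v t)"
    by (metis M inner_commute matrix_inv_sym_pos_def_self_adjoint)
  ultimately have kin: "((\<lambda>t. v t \<bullet> (?N *v v t)) has_vector_derivative 2 * (v' \<bullet> (?N *v v t))) (at t)"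
    by simp
  have "((\<lambda>t. U (u t)) has_vector_derivative u' \<bullet> d) (at t)"
    using has_derivative_compose[OF u[unfolded has_vector_derivative_def] U[unfolded gderiv_def]]
    by (simp add: has_vector_derivative_def)
  from has_vector_derivative_diff[OF has_vector_derivative_mult_right[OF kin, of "1/2"] this]
  show ?thesis by (simp add: hamiltonian_def)
qed

theorem theorem3:
  fixes M :: "real ^ 'm ^ 'm"
    and D :: "(real ^ 'm) set"
    and U :: "real ^ 'm \<Rightarrow> real"
    and g :: "real ^ 'm \<Rightarrow> real ^ 'n"
    and q0 p0 q1 p1 :: "real ^ 'm"
    and h :: real and s :: nat
    and c :: "nat \<Rightarrow> real"
    and u v :: "real \<Rightarrow> real ^ 'm"
    and lam :: "nat \<Rightarrow> real ^ 'n"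
  assumes dims: "1 \<le> CARD('n)" "CARD('n) \<le> CARD('m)"
    and M_spd: "sym_pos_def M"
    and D_open: "open D"
    and U_analytic: "real_analytic_on U D"
    and g_quadratic: "\<And>j. quadratic_polynomial (\<lambda>q. g q $ j)"
    and constraint_spd:
      "\<And>q. q \<in> D \<Longrightarrow>
         sym_pos_def (transpose (grad_matrix g q) ** matrix_inv M ** grad_matrix g q)"
    and constraint_bounded:
      "\<exists>\<delta>>0. \<forall>q\<in>D.
         \<delta> \<le> smallest_eigenvalue (transpose (grad_matrix g q) ** matrix_inv M ** grad_matrix g q)"
    and consistent: "g q0 = 0" "transpose (grad_matrix g q0) *v (matrix_inv M *v p0) = 0"
    and h_pos: "h > 0"
    and s_pos: "s \<ge> 1"
    and nodes: "gauss_nodes s c"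
    and u_poly: "polynomial_curve s u"
    and v_poly: "polynomial_curve s v"
    and u_in_D: "\<And>t. t \<in> {0..h} \<Longrightarrow> u t \<in> D"
    and u_deriv:
      "\<And>x. x \<in> {0..1} \<Longrightarrow>
         (u has_vector_derivative
            matrix_inv M *v (\<Sum>j<s. poly (legendre01 j) x *\<^sub>R legendre_coeff h j v))
         (at (x * h))"
    and u_init: "u 0 = q0"
    and v_deriv:
      "\<And>x. x \<in> {0..1} \<Longrightarrow>
         (v has_vector_derivative
            (\<Sum>j<s. poly (legendre01 j) x *\<^sub>R legendre_coeff h j (\<lambda>t. grad U (u t)))
            - (\<Sum>j=1..s. lagrange_basis s c j x *\<^sub>R (grad_matrix g (u (c j * h)) *v lam j)))
         (at (x * h))"
    and v_init: "v 0 = p0"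
    and q1_def: "q1 = u h"
    and p1_def: "p1 = v h"
    and hidden_constraints:
      "\<And>i. i \<in> {1..s} \<Longrightarrow>
         transpose (grad_matrix g (u (c i * h))) *v (matrix_inv M *v v (c i * h)) = 0"
  shows "hamiltonian M U q1 p1 = hamiltonian M U q0 p0"
  proof -
  let ?N = "matrix_inv M"
  define F where "F t = grad U (u t)" for t
  define B where "B j = grad_matrix g (u (c j * h)) *v lam j" for j
  define proj where "proj w x = (\<Sum>j<s. poly (legendre01 j) x *\<^sub>R legendre_coeff h j w)"
    for w :: "real \<Rightarrow> real ^ 'm" and x
  define R where "R x = (\<Sum>j=1..s. lagrange_basis s c j x *\<^sub>R B j)" for x
  have Nv_poly: "polynomial_curve s (\<lambda>t. ?N *v v t)"
    by (rule polynomial_curve_linear_image[OF v_poly matrix_vector_mul_linear])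
  have range: "x * h \<in> {0..h}" if "x \<in> {0..1}" for x
    using that h_pos by (simp add: mult_left_le_one_le)
  have v_cont: "continuous_on {0..1} (\<lambda>x. v (x * h))"
    and Nv_cont: "continuous_on {0..1} (\<lambda>x. ?N *v v (x * h))"
    and u_cont: "continuous_on {0..1} (\<lambda>x. u (x * h))"
    using polynomial_curve_continuous[OF v_poly] polynomial_curve_continuous[OF Nv_poly]
      polynomial_curve_continuous[OF u_poly]
    by (auto intro!: continuous_on_compose2[where f = "\<lambda>x. x * h" and t = UNIV] continuous_intros)
  have F_cont: "continuous_on {0..1} (\<lambda>x. F (x * h))"
    unfolding F_def
    by (rule continuous_on_compose2[OF real_analytic_on_continuous_grad[OF U_analytic] u_cont])
      (use u_in_D range in blast)
  \<comment> \<open>The constraint forces do no work: transposing \<open>\<nabla>g\<close> turns the power at a node into the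
    hidden constraint.\<close>
  have constraint_work: "((\<lambda>x. R x \<bullet> (?N *v v (x * h))) has_integral 0) {0..1}"
  proof -
    have "((\<lambda>x. lagrange_basis s c j x * (B j \<bullet> (?N *v v (x * h)))) has_integral 0) {0..1}"
      if j: "j \<in> {1..s}" for j
    proof (rule lagrange_curve_has_integral_0[OF nodes Nv_poly j])
      have "B j \<bullet> (?N *v v (c j * h)) =
          lam j \<bullet> (transpose (grad_matrix g (u (c j * h))) *v (?N *v v (c j * h)))"
        unfolding B_def by (metis dot_lmul_matrix transpose_matrix_vector transpose_transpose)
      then show "B j \<bullet> (?N *v v (c j * h)) = 0"
        using hidden_constraints[OF j] by simp
    qed
    from has_integral_sum[OF _ this, of "{1..s}" "\<lambda>j. j"]
    show ?thesis by (simp add: R_def inner_sum_left)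
  qed
  \<comment> \<open>The potential force enters the change of kinetic and of potential energy through the same sum
    of Legendre coefficients.\<close>
  have kinetic: "((\<lambda>x. proj F x \<bullet> (?N *v v (x * h))) has_integral
      (\<Sum>j<s. legendre_coeff h j F \<bullet> (?N *v legendre_coeff h j v))) {0..1}"
    using legendre_projection_inner_has_integral[OF Nv_cont]
    by (simp add: proj_def legendre_coeff_matrix[OF v_cont])
  have "((\<lambda>x. (\<Sum>j<s. poly (legendre01 j) x *\<^sub>R (?N *v legendre_coeff h j v)) \<bullet> F (x * h)) has_integral
      (\<Sum>j<s. (?N *v legendre_coeff h j v) \<bullet> legendre_coeff h j F)) {0..1}"
    by (rule legendre_projection_inner_has_integral[OF F_cont])
  then have potential: "((\<lambda>x. (?N *v proj v x) \<bullet> F (x * h)) has_integral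
      (\<Sum>j<s. legendre_coeff h j F \<bullet> (?N *v legendre_coeff h j v))) {0..1}"
    by (simp add: proj_def linear_sum[OF matrix_vector_mul_linear] matrix_vector_mult_scaleR inner_commute)
  \<comment> \<open>The rate of change of the energy with respect to time, at time \<open>x * h\<close>.\<close>
  define P where "P x = (proj F x - R x) \<bullet> (?N *v v (x * h)) - (?N *v proj v x) \<bullet> F (x * h)" for x
  have "((\<lambda>x. proj F x \<bullet> (?N *v v (x * h)) - R x \<bullet> (?N *v v (x * h)) - (?N *v proj v x) \<bullet> F (x * h))
      has_integral 0) {0..1}"
    using has_integral_diff[OF has_integral_diff[OF kinetic constraint_work] potential] by simp
  then have P_zero: "(P has_integral 0) {0..1}"
    by (simp add: P_def[abs_def] inner_diff_left)
  have deriv: "((\<lambda>x. hamiltonian M U (u (x * h)) (v (x * h))) has_vector_derivative h *\<^sub>R P x)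
      (at x within {0..1})" if x: "x \<in> {0..1}" for x
  proof -
    have E: "((\<lambda>t. hamiltonian M U (u t) (v t)) has_vector_derivative P x) (at (x * h))"
      unfolding P_def proj_def R_def B_def F_def[abs_def]
      by (intro hamiltonian_has_vector_derivative M_spd u_deriv v_deriv x
          real_analytic_on_GDERIV[OF U_analytic] u_in_D range)
    have "((\<lambda>x. x * h) has_vector_derivative h) (at x)"
      by (auto intro!: derivative_eq_intros)
    from vector_diff_chain_at[OF this E] show ?thesis
      by (simp add: o_def has_vector_derivative_at_within)
  qed
  have "((\<lambda>x. h *\<^sub>R P x) has_integral
      hamiltonian M U (u (1 * h)) (v (1 * h)) - hamiltonian M U (u (0 * h)) (v (0 * h))) {0..1}"
    by (intro fundamental_theorem_of_calculus deriv) auto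
  moreover have "((\<lambda>x. h *\<^sub>R P x) has_integral 0) {0..1}"
    using has_integral_cmul[OF P_zero, of h] by simp
  ultimately have "hamiltonian M U (u (1 * h)) (v (1 * h)) - hamiltonian M U (u (0 * h)) (v (0 * h)) = 0"
    by (rule has_integral_unique)
  then show ?thesis
    by (simp add: q1_def p1_def u_init v_init)
qed

end
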